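(* Suppose there exists a constant $\alpha$ such that for every Boolean function $f:\{0,1\}^n\to\{0,1\}$ (for every $n$), $\mathsf{mbs}(f)=O(\log^{\alpha}\mathsf{spar}(f))$. Then for every Boolean function $f:\{0,1\}^n\to\{0,1\}$, $\mathsf{s}(f)=O(\deg^{\alpha}(f))$.
   Context: Every $f:\{0,1\}^n\to\{0,1\}$ has a unique multilinear representation $f(x)=\sum_{S\subseteq[n]}\alpha_S\prod_{i\in S}x_i$ over $\mathbb{R}$; $\mathsf{spar}(f)=|\{S\neq\emptyset:\alpha_S\neq 0\}|$ and $\deg(f)=\max\{|S|:\alpha_S\ne0\}$. Sensitivity: $\mathsf{s}(f,x)=|\{i: f(x^{\oplus i})\ne f(x)\}|$ where $x^{\oplus i}$ flips bit $i$, and $\mathsf{s}(f)=\max_x\mathsf{s}(f,x)$. For $x$, with $\mathrm{supp}(x)=\{i:x_i=1\}$ and $x^B$ denoting $x$ with the bits in $B$ flipped, a monotone sensitive block at $x$ is a nonempty $B\subseteq[n]\setminus\mathrm{supp}(x)$ with $f(x^B)\ne f(x)$; $\mathsf{mbs}(f,x)$ is the maximum number of pairwise disjoint monotone sensitive blocks at $x$, and $\mathsf{mbs}(f)=\max_x\mathsf{mbs}(f,x)$. *)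

theory Defs
  imports Complex_Main "HOL-Library.FuncSet" "HOL-Library.Disjoint_Sets"
begin

(* The index set [n] is {..<n}.  A Boolean function on n variables is given by a map
   f :: (nat => bool) => bool of which only the values on cube n are ever used;
   n is a parameter of every complexity measure. *)

definition cube :: "nat \<Rightarrow> (nat \<Rightarrow> bool) set" where
  "cube n = {..<n} \<rightarrow>\<^sub>E UNIV"

definition flip :: "nat set \<Rightarrow> (nat \<Rightarrow> bool) \<Rightarrow> nat \<Rightarrow> bool" where
  "flip B x = (\<lambda>i. if i \<in> B then \<not> x i else x i)"

definition supp :: "nat \<Rightarrow> (nat \<Rightarrow> bool) \<Rightarrow> nat set" where
  "supp n x = {i. i < n \<and> x i}"

(* The coefficient family a is made total by setting it to 0 off the subsets of [n]. *)
definition multilinear_rep :: "nat \<Rightarrow> ((nat \<Rightarrow> bool) \<Rightarrow> bool) \<Rightarrow> (nat set \<Rightarrow> real) \<Rightarrow> bool" where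
  "multilinear_rep n f a \<longleftrightarrow>
     (\<forall>S. \<not> S \<subseteq> {..<n} \<longrightarrow> a S = 0) \<and>
     (\<forall>x\<in>cube n. of_bool (f x) = (\<Sum>S\<in>Pow {..<n}. a S * (\<Prod>i\<in>S. of_bool (x i))))"

definition coef :: "nat \<Rightarrow> ((nat \<Rightarrow> bool) \<Rightarrow> bool) \<Rightarrow> nat set \<Rightarrow> real" where
  "coef n f = (THE a. multilinear_rep n f a)"

definition spar :: "nat \<Rightarrow> ((nat \<Rightarrow> bool) \<Rightarrow> bool) \<Rightarrow> nat" where
  "spar n f = card {S. S \<subseteq> {..<n} \<and> S \<noteq> {} \<and> coef n f S \<noteq> 0}"

(* The inserted 0 only matters for f = 0, which has no nonzero coefficient and gets degree 0. *)
definition deg :: "nat \<Rightarrow> ((nat \<Rightarrow> bool) \<Rightarrow> bool) \<Rightarrow> nat" where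
  "deg n f = Max (insert 0 {card S |S. S \<subseteq> {..<n} \<and> coef n f S \<noteq> 0})"

definition sens_at :: "nat \<Rightarrow> ((nat \<Rightarrow> bool) \<Rightarrow> bool) \<Rightarrow> (nat \<Rightarrow> bool) \<Rightarrow> nat" where
  "sens_at n f x = card {i. i < n \<and> f (flip {i} x) \<noteq> f x}"

definition sens :: "nat \<Rightarrow> ((nat \<Rightarrow> bool) \<Rightarrow> bool) \<Rightarrow> nat" where
  "sens n f = Max (sens_at n f ` cube n)"

definition monotone_sensitive_block ::
    "nat \<Rightarrow> ((nat \<Rightarrow> bool) \<Rightarrow> bool) \<Rightarrow> (nat \<Rightarrow> bool) \<Rightarrow> nat set \<Rightarrow> bool" where
  "monotone_sensitive_block n f x B \<longleftrightarrow>
     B \<noteq> {} \<and> B \<subseteq> {..<n} - supp n x \<and> f (flip B x) \<noteq> f x"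

(* Blocks are nonempty, so pairwise disjoint blocks are distinct and a set of blocks suffices. *)
definition mbs_at :: "nat \<Rightarrow> ((nat \<Rightarrow> bool) \<Rightarrow> bool) \<Rightarrow> (nat \<Rightarrow> bool) \<Rightarrow> nat" where
  "mbs_at n f x =
     Max {card \<B> |\<B>. (\<forall>B\<in>\<B>. monotone_sensitive_block n f x B) \<and> disjoint \<B>}"

definition mbs :: "nat \<Rightarrow> ((nat \<Rightarrow> bool) \<Rightarrow> bool) \<Rightarrow> nat" where
  "mbs n f = Max (mbs_at n f ` cube n)"

lemma finite_cube [simp]: "finite (cube n)"
  by (simp add: cube_def finite_PiE)

lemma cube_nonempty [simp]: "cube n \<noteq> {}"
  by (simp add: cube_def PiE_eq_empty_iff)

lemma flip_in_cube: "x \<in> cube n \<Longrightarrow> B \<subseteq> {..<n} \<Longrightarrow> flip B x \<in> cube n"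
  by (auto simp: cube_def flip_def PiE_def extensional_def)

lemma finite_mbs_at_set:
  "finite {card \<B> |\<B>. (\<forall>B\<in>\<B>. monotone_sensitive_block n f x B) \<and> disjoint \<B>}"
proof (rule finite_subset)
  show "{card \<B> |\<B>. (\<forall>B\<in>\<B>. monotone_sensitive_block n f x B) \<and> disjoint \<B>}
          \<subseteq> card ` Pow (Pow {..<n})"
    by (fastforce simp: monotone_sensitive_block_def)
qed simp

lemma multilinear_eval:
  assumes "x \<in> cube n"
  shows "(\<Sum>S\<in>Pow {..<n}. a S * (\<Prod>i\<in>S. of_bool (x i))) = (sum a (Pow (supp n x)) :: real)"
proof -
  have "(\<Sum>S\<in>Pow {..<n}. a S * (\<Prod>i\<in>S. of_bool (x i)))
      = (\<Sum>S\<in>Pow {..<n}. if S \<subseteq> supp n x then a S else 0)"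
  proof (rule sum.cong[OF refl])
    fix S assume S: "S \<in> Pow {..<n}"
    then have "finite S" using finite_subset by auto
    then have "(\<Prod>i\<in>S. of_bool (x i)) = (of_bool (S \<subseteq> supp n x) :: real)"
      using S by (cases "S \<subseteq> supp n x") (auto simp: supp_def intro!: prod.neutral)
    then show "a S * (\<Prod>i\<in>S. of_bool (x i)) = (if S \<subseteq> supp n x then a S else 0)"
      by simp
  qed
  also have "\<dots> = sum a {S \<in> Pow {..<n}. S \<subseteq> supp n x}"
    by (rule sum.inter_filter[symmetric]) simp
  also have "{S \<in> Pow {..<n}. S \<subseteq> supp n x} = Pow (supp n x)"
    by (auto simp: supp_def)
  finally show ?thesis .
qed

lemma ex1_multilinear_rep: "\<exists>!a. multilinear_rep n f a"
proof
  define point where "point T = (\<lambda>i\<in>{..<n}. i \<in> T)" for T :: "nat set"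
  define val :: "nat set \<Rightarrow> real" where "val T = of_bool (f (point T))" for T
  define g where "g S = (\<Sum>T\<in>Pow S. (-1) ^ card T * val T)" for S
  define a where "a S = (if S \<subseteq> {..<n} then (-1) ^ card S * g S else 0)" for S
  have inv: "val S = (\<Sum>T\<in>Pow S. (-1) ^ card T * g T)" if "finite S" for S
    by (rule inclusion_exclusion_symmetric[OF _ that]) (simp add: g_def)
  have point_supp: "point (supp n x) = x" if "x \<in> cube n" for x
    using that by (auto simp: point_def supp_def cube_def fun_eq_iff PiE_def extensional_def)
  have supp_sub: "supp n x \<subseteq> {..<n}" for x
    by (auto simp: supp_def)
  have fin: "finite (supp n x)" for x
    using supp_sub finite_subset by blast
  have supp_point: "supp n (point T) = T" if "T \<subseteq> {..<n}" for T
    using that by (auto simp: point_def supp_def)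
  have point_cube: "point T \<in> cube n" for T
    by (auto simp: point_def cube_def)
  have "of_bool (f x) = sum a (Pow (supp n x))" if x: "x \<in> cube n" for x
  proof -
    have "sum a (Pow (supp n x)) = (\<Sum>T\<in>Pow (supp n x). (-1) ^ card T * g T)"
      using supp_sub by (intro sum.cong) (auto simp: a_def)
    also have "\<dots> = val (supp n x)"
      using inv[OF fin] by simp
    finally show ?thesis
      by (simp add: val_def point_supp[OF x])
  qed
  moreover have "a S = 0" if "\<not> S \<subseteq> {..<n}" for S
    using that by (simp add: a_def)
  ultimately show rep: "multilinear_rep n f a"
    by (simp add: multilinear_rep_def multilinear_eval)
  fix b assume b: "multilinear_rep n f b"
  have "b S = a S" if "S \<subseteq> {..<n}" for S
  proof -
    have "finite S" using that finite_subset by blast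
    then show ?thesis using that
    proof (induction S rule: finite_psubset_induct)
      case (psubset S)
      have "sum b (Pow S) = sum a (Pow S)"
        using b rep point_cube[of S] multilinear_eval[OF point_cube[of S]]
          supp_point[OF psubset.prems]
        by (simp add: multilinear_rep_def) metis
      moreover have "sum b (Pow S - {S}) = sum a (Pow S - {S})"
        using psubset by (intro sum.cong) auto
      moreover have "sum c (Pow S) = c S + sum c (Pow S - {S})" for c :: "nat set \<Rightarrow> real"
        using psubset.hyps by (intro sum.remove) auto
      ultimately show ?case by simp
    qed
  qed
  then show "b = a"
    using b by (auto simp: fun_eq_iff a_def multilinear_rep_def)
qed

lemma multilinear_rep_coef: "multilinear_rep n f (coef n f)"
  unfolding coef_def by (rule theI'[OF ex1_multilinear_rep])

end

theory Submission
  imports Defs "HOL-Real_Asymp.Real_Asymp"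
begin

text \<open>
  Restricting a function \<open>f\<close> of degree \<open>d\<close> to its \<open>s\<close> sensitive coordinates at a point of
  maximal sensitivity and moving that point to the origin, one may assume that \<open>f\<close> has \<open>s\<close>
  variables and is sensitive at \<open>0\<close> in all of them. This property is inherited by the \<open>k\<close>-fold
  composition of \<open>f\<close> with itself, which has \<open>s\<^sup>k\<close> variables and degree at most \<open>d\<^sup>k\<close>. Its
  monotone block sensitivity is at least \<open>s\<^sup>k\<close>, while the logarithm of its sparsity is at most
  \<open>d\<^sup>k log (s\<^sup>k + 1)\<close>, the logarithm of a bound on the number of available monomials. Hence
  \<open>s\<^sup>k \<le> C (k s d\<^sup>k)\<^sup>\<alpha>\<close> for all large \<open>k\<close>, and taking \<open>k\<close>-th roots gives \<open>s \<le> d\<^sup>\<alpha>\<close>.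
\<close>

section \<open>Functions on the cube of bounded degree\<close>

text \<open>Real values are allowed because sums and products of Boolean functions need not be
  Boolean. With the coefficients existentially quantified, closure under these operations only
  requires exhibiting a family.\<close>

definition degree_at_most :: "nat \<Rightarrow> nat \<Rightarrow> ((nat \<Rightarrow> bool) \<Rightarrow> real) \<Rightarrow> bool" where
  "degree_at_most n d \<phi> \<longleftrightarrow>
     (\<exists>a. (\<forall>S. a S \<noteq> 0 \<longrightarrow> S \<subseteq> {..<n} \<and> card S \<le> d) \<and>
          (\<forall>x\<in>cube n. \<phi> x = (\<Sum>S\<in>Pow {..<n}. a S * (\<Prod>i\<in>S. of_bool (x i)))))"

lemma degree_at_mostI:
  assumes "\<And>S. a S \<noteq> 0 \<Longrightarrow> S \<subseteq> {..<n} \<and> card S \<le> d"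
    and "\<And>x. x \<in> cube n \<Longrightarrow> \<phi> x = (\<Sum>S\<in>Pow {..<n}. a S * (\<Prod>i\<in>S. of_bool (x i)))"
  shows "degree_at_most n d \<phi>"
  unfolding degree_at_most_def using assms by blast

lemma degree_at_mostE:
  assumes "degree_at_most n d \<phi>"
  obtains a where "\<And>S. a S \<noteq> 0 \<Longrightarrow> S \<subseteq> {..<n} \<and> card S \<le> d"
    and "\<And>x. x \<in> cube n \<Longrightarrow> \<phi> x = (\<Sum>S\<in>Pow {..<n}. a S * (\<Prod>i\<in>S. of_bool (x i)))"
  using assms unfolding degree_at_most_def by blast

lemma degree_at_most_cong:
  "degree_at_most n d \<phi> \<Longrightarrow> (\<And>x. x \<in> cube n \<Longrightarrow> \<psi> x = \<phi> x) \<Longrightarrow> degree_at_most n d \<psi>"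
  unfolding degree_at_most_def by simp

lemma degree_at_most_mono:
  "degree_at_most n d \<phi> \<Longrightarrow> d \<le> e \<Longrightarrow> degree_at_most n e \<phi>"
  unfolding degree_at_most_def by (blast intro: order.trans)

lemma degree_at_most_monom:
  assumes "S \<subseteq> {..<n}" "card S \<le> d"
  shows "degree_at_most n d (\<lambda>x. c * (\<Prod>i\<in>S. of_bool (x i)))"
proof (rule degree_at_mostI)
  fix x
  have "(\<Sum>T\<in>Pow {..<n}. (if T = S then c else 0) * (\<Prod>i\<in>T. of_bool (x i)))
      = (\<Sum>T\<in>Pow {..<n}. if T = S then c * (\<Prod>i\<in>T. of_bool (x i)) else 0)"
    by (intro sum.cong) auto
  then show "c * (\<Prod>i\<in>S. of_bool (x i))
      = (\<Sum>T\<in>Pow {..<n}. (if T = S then c else 0) * (\<Prod>i\<in>T. of_bool (x i)))"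
    using assms by simp
qed (use assms in \<open>auto split: if_splits\<close>)

lemma degree_at_most_const: "degree_at_most n d (\<lambda>x. c)"
  using degree_at_most_monom[of "{}" n d c] by simp

lemma degree_at_most_var: "i < n \<Longrightarrow> degree_at_most n 1 (\<lambda>x. of_bool (x i))"
  using degree_at_most_monom[of "{i}" n 1 1] by simp

lemma degree_at_most_add:
  assumes "degree_at_most n d \<phi>" "degree_at_most n d \<psi>"
  shows "degree_at_most n d (\<lambda>x. \<phi> x + \<psi> x)"
proof -
  obtain a where a: "\<And>S. a S \<noteq> 0 \<Longrightarrow> S \<subseteq> {..<n} \<and> card S \<le> d"
    "\<And>x. x \<in> cube n \<Longrightarrow> \<phi> x = (\<Sum>S\<in>Pow {..<n}. a S * (\<Prod>i\<in>S. of_bool (x i)))"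
    using assms(1) by (rule degree_at_mostE) blast
  obtain b where b: "\<And>S. b S \<noteq> 0 \<Longrightarrow> S \<subseteq> {..<n} \<and> card S \<le> d"
    "\<And>x. x \<in> cube n \<Longrightarrow> \<psi> x = (\<Sum>S\<in>Pow {..<n}. b S * (\<Prod>i\<in>S. of_bool (x i)))"
    using assms(2) by (rule degree_at_mostE) blast
  show ?thesis
  proof (rule degree_at_mostI)
    show "S \<subseteq> {..<n} \<and> card S \<le> d" if "a S + b S \<noteq> 0" for S
      using that a(1)[of S] b(1)[of S] by fastforce
  qed (simp add: a(2) b(2) distrib_right sum.distrib)
qed

lemma degree_at_most_sum:
  assumes "\<And>j. j \<in> J \<Longrightarrow> degree_at_most n d (\<phi> j)"
  shows "degree_at_most n d (\<lambda>x. \<Sum>j\<in>J. \<phi> j x)"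
  using assms
  by (induction J rule: infinite_finite_induct)
    (auto simp: degree_at_most_const intro: degree_at_most_add)

text \<open>On the cube x_i^2 = x_i, so the monomials of \<open>S\<close> and \<open>T\<close>
  multiply to the monomial of \<open>S \<union> T\<close>, whose degree is at most
  \<open>card S + card T\<close>.\<close>

lemma degree_at_most_mult:
  assumes "degree_at_most n d \<phi>" "degree_at_most n e \<psi>"
  shows "degree_at_most n (d + e) (\<lambda>x. \<phi> x * \<psi> x)"
proof -
  obtain a where a: "\<And>S. a S \<noteq> 0 \<Longrightarrow> S \<subseteq> {..<n} \<and> card S \<le> d"
    "\<And>x. x \<in> cube n \<Longrightarrow> \<phi> x = (\<Sum>S\<in>Pow {..<n}. a S * (\<Prod>i\<in>S. of_bool (x i)))"
    using assms(1) by (rule degree_at_mostE) blast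
  obtain b where b: "\<And>S. b S \<noteq> 0 \<Longrightarrow> S \<subseteq> {..<n} \<and> card S \<le> e"
    "\<And>x. x \<in> cube n \<Longrightarrow> \<psi> x = (\<Sum>S\<in>Pow {..<n}. b S * (\<Prod>i\<in>S. of_bool (x i)))"
    using assms(2) by (rule degree_at_mostE) blast
  have "degree_at_most n (d + e)
     (\<lambda>x. \<Sum>S\<in>Pow {..<n}. \<Sum>T\<in>Pow {..<n}. (a S * b T) * (\<Prod>i\<in>S \<union> T. of_bool (x i)))"
  proof (intro degree_at_most_sum)
    fix S T assume ST: "S \<in> Pow {..<n}" "T \<in> Pow {..<n}"
    show "degree_at_most n (d + e) (\<lambda>x. (a S * b T) * (\<Prod>i\<in>S \<union> T. of_bool (x i)))"
    proof (cases "a S * b T = 0")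
      case True
      then show ?thesis using degree_at_most_const[of n "d + e" 0] by (simp only: mult_zero_left)
    next
      case False
      then have "card S \<le> d" "card T \<le> e" using a(1)[of S] b(1)[of T] by auto
      then show ?thesis
        using ST card_Un_le[of S T] by (intro degree_at_most_monom) auto
    qed
  qed
  then show ?thesis
  proof (rule degree_at_most_cong)
    fix x assume x: "x \<in> cube n"
    have union: "(\<Prod>i\<in>S \<union> T. of_bool (x i))
        = ((\<Prod>i\<in>S. of_bool (x i)) * (\<Prod>i\<in>T. of_bool (x i)) :: real)"
      if "S \<in> Pow {..<n}" "T \<in> Pow {..<n}" for S T
    proof -
      have "finite S" "finite T" using that finite_subset by auto
      moreover have "(\<Prod>i\<in>R. of_bool (x i)) = (of_bool (\<forall>i\<in>R. x i) :: real)"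
        if "finite R" for R
        using that by (induction R rule: finite_induct) auto
      ultimately show ?thesis by (simp add: ball_Un)
    qed
    show "\<phi> x * \<psi> x
        = (\<Sum>S\<in>Pow {..<n}. \<Sum>T\<in>Pow {..<n}. (a S * b T) * (\<Prod>i\<in>S \<union> T. of_bool (x i)))"
      unfolding a(2)[OF x] b(2)[OF x] sum_product
      by (intro sum.cong refl) (simp add: union mult_ac)
  qed
qed

lemma degree_at_most_prod:
  assumes "\<And>j. j \<in> J \<Longrightarrow> degree_at_most n e (\<phi> j)"
  shows "degree_at_most n (card J * e) (\<lambda>x. \<Prod>j\<in>J. \<phi> j x)"
  using assms
  by (induction J rule: infinite_finite_induct)
    (auto simp: degree_at_most_const intro: degree_at_most_mult)

section \<open>The degree of a Boolean function and substitution into it\<close>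

lemma deg_le_iff: "deg n f \<le> d \<longleftrightarrow> (\<forall>S. S \<subseteq> {..<n} \<and> coef n f S \<noteq> 0 \<longrightarrow> card S \<le> d)"
proof -
  have "finite {card S |S. S \<subseteq> {..<n} \<and> coef n f S \<noteq> 0}"
    by (rule finite_subset[of _ "card ` Pow {..<n}"]) auto
  then show ?thesis unfolding deg_def by auto
qed

text \<open>By uniqueness of the multilinear representation, any family witnessing the bound equals
  \<open>coef n f\<close>.\<close>

lemma deg_le_iff_degree_at_most:
  "deg n f \<le> d \<longleftrightarrow> degree_at_most n d (\<lambda>x. of_bool (f x))"
proof
  assume "deg n f \<le> d"
  then show "degree_at_most n d (\<lambda>x. of_bool (f x))"
    using multilinear_rep_coef[of n f]
    by (intro degree_at_mostI[of "coef n f"]) (auto simp: deg_le_iff multilinear_rep_def)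
next
  assume "degree_at_most n d (\<lambda>x. of_bool (f x))"
  then obtain a :: "nat set \<Rightarrow> real"
    where a: "\<And>S. a S \<noteq> 0 \<Longrightarrow> S \<subseteq> {..<n} \<and> card S \<le> d"
    "\<And>x. x \<in> cube n \<Longrightarrow>
      of_bool (f x) = (\<Sum>S\<in>Pow {..<n}. a S * (\<Prod>i\<in>S. of_bool (x i)))"
    by (rule degree_at_mostE) blast
  then have "multilinear_rep n f a" unfolding multilinear_rep_def by blast
  then have "coef n f = a"
    using ex1_multilinear_rep multilinear_rep_coef by blast
  then show "deg n f \<le> d" using a(1) by (auto simp: deg_le_iff)
qed

text \<open>Each monomial of \<open>f\<close> turns into a product of at most \<open>d\<close>
  functions of degree at most \<open>e\<close>. The values of \<open>u\<close> must lie in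
  \<open>cube n\<close> because \<open>f\<close> agrees with its polynomial only there.\<close>

lemma degree_at_most_substitute:
  assumes "deg n f \<le> d"
    and u: "\<And>i. i < n \<Longrightarrow> degree_at_most m e (\<lambda>y. of_bool (u y i))"
    and cube: "\<And>y. y \<in> cube m \<Longrightarrow> u y \<in> cube n"
  shows "degree_at_most m (d * e) (\<lambda>y. of_bool (f (u y)))"
proof -
  have "degree_at_most m (d * e)
      (\<lambda>y. \<Sum>S\<in>Pow {..<n}. coef n f S * (\<Prod>i\<in>S. of_bool (u y i)))"
  proof (rule degree_at_most_sum)
    fix S assume S: "S \<in> Pow {..<n}"
    show "degree_at_most m (d * e) (\<lambda>y. coef n f S * (\<Prod>i\<in>S. of_bool (u y i)))"
    proof (cases "coef n f S = 0")
      case True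
      then show ?thesis by (simp add: degree_at_most_const)
    next
      case False
      then have "card S * e \<le> d * e"
        using assms(1) S by (auto simp: deg_le_iff)
      moreover have "degree_at_most m (0 + card S * e)
          (\<lambda>y. coef n f S * (\<Prod>i\<in>S. of_bool (u y i)))"
        using S u by (intro degree_at_most_mult degree_at_most_prod degree_at_most_const) auto
      ultimately show ?thesis by (auto intro: degree_at_most_mono)
    qed
  qed
  then show ?thesis
    by (rule degree_at_most_cong)
      (use multilinear_rep_coef[of n f] cube in \<open>simp add: multilinear_rep_def\<close>)
qed

section \<open>Functions that are sensitive at the origin in every variable\<close>

text \<open>The indicator vector of \<open>T\<close>; the restriction makes it
  \<open>undefined\<close> off \<open>{..<n}\<close>, as membership in \<open>cube n\<close>
  demands.\<close>

definition point :: "nat \<Rightarrow> nat set \<Rightarrow> nat \<Rightarrow> bool" where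
  "point n T = (\<lambda>i\<in>{..<n}. i \<in> T)"

text \<open>Sensitivity at the origin is normalised to the values 0 at the origin and 1 at the unit
  vectors. Inner functions of a composition then feed the outer one again with the origin or a unit
  vector.\<close>

definition fully_sensitive :: "nat \<Rightarrow> ((nat \<Rightarrow> bool) \<Rightarrow> bool) \<Rightarrow> bool" where
  "fully_sensitive n f \<longleftrightarrow> \<not> f (point n {}) \<and> (\<forall>i<n. f (point n {i}))"

lemma point_in_cube: "point n T \<in> cube n"
  by (auto simp: point_def cube_def)

lemma supp_point: "T \<subseteq> {..<n} \<Longrightarrow> supp n (point n T) = T"
  by (auto simp: point_def supp_def)

lemma flip_point_empty: "i < n \<Longrightarrow> flip {i} (point n {}) = point n {i}"
  by (auto simp: point_def flip_def)

text \<open>The linear coefficient of x_i is the value at the i-th unit vector minus the value at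
  the origin, that is 1 - 0.\<close>

lemma fully_sensitive_coef_singleton:
  assumes "fully_sensitive n f" "i < n"
  shows "coef n f {i} = 1"
proof -
  have eval: "of_bool (f x) = sum (coef n f) (Pow (supp n x))" if "x \<in> cube n" for x
    using multilinear_rep_coef[of n f] multilinear_eval[OF that, of "coef n f"] that
    by (simp add: multilinear_rep_def)
  have "coef n f {} = 0"
    using eval[OF point_in_cube[of n "{}"]] assms by (simp add: supp_point fully_sensitive_def)
  then show ?thesis
    using eval[OF point_in_cube[of n "{i}"]] assms
    by (simp add: supp_point fully_sensitive_def Pow_insert)
qed

lemma fully_sensitive_deg_pos:
  assumes "fully_sensitive n f" "n > 0"
  shows "deg n f > 0"
proof (rule ccontr)
  assume "\<not> deg n f > 0"
  then have "deg n f \<le> 0" by simp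
  moreover have "coef n f {0} \<noteq> 0" "{0} \<subseteq> {..<n}"
    using fully_sensitive_coef_singleton[OF assms] assms(2) by auto
  ultimately have "card {0::nat} \<le> 0" unfolding deg_le_iff by blast
  then show False by simp
qed

text \<open>All \<open>n\<close> linear monomials occur. Along composition powers this pushes the
  sparsity beyond any threshold, so that an asymptotic hypothesis becomes applicable.\<close>

lemma fully_sensitive_spar_ge:
  assumes "fully_sensitive n f"
  shows "n \<le> spar n f"
proof -
  have "card ((\<lambda>i. {i}) ` {..<n}) \<le> spar n f"
    unfolding spar_def
    by (rule card_mono) (auto simp: fully_sensitive_coef_singleton[OF assms])
  then show ?thesis by (simp add: card_image)
qed

text \<open>The origin has empty support, so the \<open>n\<close> singletons are disjoint monotone
  sensitive blocks there.\<close>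

lemma fully_sensitive_mbs_ge:
  assumes "fully_sensitive n f"
  shows "n \<le> mbs n f"
proof -
  let ?\<B> = "(\<lambda>i. {i}) ` {..<n}"
  have "\<forall>B\<in>?\<B>. monotone_sensitive_block n f (point n {}) B"
    using assms
    by (auto simp: monotone_sensitive_block_def flip_point_empty supp_point fully_sensitive_def)
  moreover have "disjoint ?\<B>" by (auto simp: disjoint_def)
  ultimately have "card ?\<B> \<le> mbs_at n f (point n {})"
    unfolding mbs_at_def by (intro Max_ge[OF finite_mbs_at_set]) blast
  also have "\<dots> \<le> mbs n f"
    unfolding mbs_def by (intro Max_ge) (auto simp: point_in_cube)
  finally show ?thesis by (simp add: card_image)
qed

text \<open>
  A set of at most \<open>d\<close> elements of \<open>{..<n}\<close> is listed by a word of length \<open>d\<close> over \<open>{..n}\<close>, with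
  \<open>n\<close> as padding.
\<close>
lemma spar_le_of_deg:
  assumes "deg n f \<le> d"
  shows "spar n f \<le> (n + 1) ^ d"
proof -
  let ?W = "{xs. set xs \<subseteq> {..n} \<and> length xs = d}"
  have W: "finite ?W" "card ?W = (n + 1) ^ d"
    using finite_lists_length_eq[of "{..n}" d] card_lists_length_eq[of "{..n}" d] by auto
  have "{S. S \<subseteq> {..<n} \<and> S \<noteq> {} \<and> coef n f S \<noteq> 0} \<subseteq> (\<lambda>xs. set xs \<inter> {..<n}) ` ?W"
  proof
    fix S assume "S \<in> {S. S \<subseteq> {..<n} \<and> S \<noteq> {} \<and> coef n f S \<noteq> 0}"
    then have S: "S \<subseteq> {..<n}" "card S \<le> d" using assms by (auto simp: deg_le_iff)
    then obtain ys where ys: "set ys = S" "distinct ys"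
      using finite_distinct_list[of S] finite_subset by auto
    let ?xs = "ys @ replicate (d - card S) n"
    have "length ?xs = d" using ys S distinct_card[of ys] by simp
    moreover have "set ?xs \<subseteq> {..n}" using ys S by (auto dest: subsetD)
    moreover have "S = set ?xs \<inter> {..<n}" using ys S by auto
    ultimately show "S \<in> (\<lambda>xs. set xs \<inter> {..<n}) ` ?W" by blast
  qed
  from surj_card_le[OF W(1) this] show ?thesis by (simp add: spar_def W(2))
qed

text \<open>The witness applies \<open>g\<close> to \<open>n\<close> disjoint blocks of
  \<open>m\<close> variables and \<open>f\<close> to the results. At the origin every block yields
  0; at the unit vector of \<open>l\<close> exactly the block \<open>l div m\<close> yields 1, so
  \<open>f\<close> sees a unit vector.\<close>

lemma fully_sensitive_compose:
  assumes f: "fully_sensitive n f" "deg n f \<le> d" and g: "fully_sensitive m g" "deg m g \<le> e"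
  shows "\<exists>h. fully_sensitive (n * m) h \<and> deg (n * m) h \<le> d * e"
proof -
  \<comment> \<open>\<open>v x i\<close> is the \<open>i\<close>-th block of \<open>x\<close>,
    shifted to the index set \<open>{..<m}\<close>; \<open>u x\<close> lists the values of
    \<open>g\<close> on the blocks.\<close>
  define v where "v x i = (\<lambda>j\<in>{..<m}. x (i * m + j))" for x :: "nat \<Rightarrow> bool" and i
  define u where "u x = (\<lambda>i\<in>{..<n}. g (v x i))" for x
  have less: "i * m + j < n * m" if "i < n" "j < m" for i j
  proof -
    have "i * m + j < Suc i * m" using that by simp
    also have "\<dots> \<le> n * m" using that by (intro mult_le_mono1) simp
    finally show ?thesis .
  qed
  have "degree_at_most (n * m) (d * e) (\<lambda>x. of_bool (f (u x)))"
  proof (rule degree_at_most_substitute[OF f(2)])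
    fix i assume i: "i < n"
    have "degree_at_most (n * m) (e * 1) (\<lambda>x. of_bool (g (v x i)))"
      by (rule degree_at_most_substitute[OF g(2)])
        (auto simp: v_def cube_def intro!: degree_at_most_var[unfolded One_nat_def] less i)
    then show "degree_at_most (n * m) e (\<lambda>x. of_bool (u x i))"
      using i by (simp add: u_def)
  qed (auto simp: u_def cube_def)
  then have "deg (n * m) (\<lambda>x. f (u x)) \<le> d * e"
    by (simp add: deg_le_iff_degree_at_most)
  moreover have "fully_sensitive (n * m) (\<lambda>x. f (u x))"
    unfolding fully_sensitive_def
  proof (intro conjI allI impI)
    have "v (point (n * m) {}) i = point m {}" if "i < n" for i
      using that less by (auto simp: v_def point_def fun_eq_iff)
    then have "u (point (n * m) {}) = point n {}"
      using g(1) unfolding u_def point_def[of n] fully_sensitive_def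
      by (intro restrict_ext) auto
    then show "\<not> f (u (point (n * m) {}))"
      using f(1) by (simp add: fully_sensitive_def)
  next
    fix l assume l: "l < n * m"
    then have m: "m > 0" by (cases m) auto
    have ldiv: "l div m < n" using l by (simp add: less_mult_imp_div_less)
    have "v (point (n * m) {l}) i = (if i = l div m then point m {l mod m} else point m {})"
      if "i < n" for i
    proof -
      have "i * m + j = l \<longleftrightarrow> i = l div m \<and> j = l mod m" if "j < m" for j
        using that by auto
      then show ?thesis
        using that less by (auto simp: v_def point_def fun_eq_iff)
    qed
    then have "u (point (n * m) {l}) = point n {l div m}"
      using g(1) m unfolding u_def point_def[of n] fully_sensitive_def
      by (intro restrict_ext) auto
    then show "f (u (point (n * m) {l}))"
      using f(1) ldiv by (simp add: fully_sensitive_def)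
  qed
  ultimately show ?thesis by blast
qed

lemma deg_le_arity: "deg n f \<le> n"
  using card_mono[of "{..<n}"] by (simp add: deg_le_iff)

lemma fully_sensitive_power:
  assumes "fully_sensitive n f" "deg n f \<le> d"
  shows "\<exists>h. fully_sensitive (n ^ k) h \<and> deg (n ^ k) h \<le> d ^ k"
proof (induction k)
  case 0
  \<comment> \<open>The empty composition is the identity in one variable, matching
    \<open>n ^ 0 = 1\<close> and \<open>d ^ 0 = 1\<close>.\<close>
  have "fully_sensitive 1 (\<lambda>x. x 0)" by (simp add: fully_sensitive_def point_def)
  then show ?case using deg_le_arity[of 1] by auto
next
  case (Suc k)
  then show ?case using fully_sensitive_compose[OF assms] by auto
qed

text \<open>Fix a point \<open>x\<close> of maximal sensitivity and let the new variables say which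
  of its sensitive coordinates to flip. Comparing the value of \<open>f\<close> with
  \<open>f x\<close> puts 0 at the origin. Every substitution is affine in at most one variable, so
  the degree does not grow.\<close>

lemma sens_restriction:
  "\<exists>g. fully_sensitive (sens n f) g \<and> deg (sens n f) g \<le> deg n f"
proof -
  define s where "s = sens n f"
  have "s \<in> sens_at n f ` cube n" unfolding s_def sens_def by (intro Max_in) auto
  then obtain x where x: "x \<in> cube n" "s = sens_at n f x" by auto
  define A where "A = {i. i < n \<and> f (flip {i} x) \<noteq> f x}"
  have "finite A" "card A = s" using x by (simp_all add: A_def sens_at_def)
  then obtain p where p: "bij_betw p {..<s} A"
    using ex_bij_betw_nat_finite[of A] by (auto simp: atLeast0LessThan)
  define u where "u y = flip (p ` supp s y) x" for y
  have pA: "p i \<in> A" if "i < s" for i using p that by (auto dest: bij_betwE)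
  have cube: "u y \<in> cube n" for y
    unfolding u_def using x pA by (intro flip_in_cube) (auto simp: supp_def A_def)
  have "degree_at_most s (deg n f * 1) (\<lambda>y. of_bool (f (u y)))"
  proof (rule degree_at_most_substitute[OF order_refl])
    fix j assume "j < n"
    show "degree_at_most s 1 (\<lambda>y. of_bool (u y j))"
    proof (cases "j \<in> A")
      case True
      then obtain i where i: "i < s" "j = p i" using p by (auto simp: bij_betw_def)
      then have mem: "j \<in> p ` supp s y \<longleftrightarrow> y i" for y
        using p by (auto simp: supp_def bij_betw_def inj_on_def)
      \<comment> \<open>Flipping the bit \<open>x j\<close> when \<open>y i\<close> holds gives the
        polynomial y_i if the bit is 0, and 1 - y_i if it is 1.\<close>
      have "degree_at_most s (0 + 1) (\<lambda>y. (if x j then - 1 else 1) * of_bool (y i))"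
        using i by (intro degree_at_most_mult degree_at_most_const degree_at_most_var)
      then have "degree_at_most s 1
          (\<lambda>y. (if x j then 1 else 0) + (if x j then - 1 else 1) * of_bool (y i))"
        by (intro degree_at_most_add degree_at_most_const) simp
      then show ?thesis
        by (rule degree_at_most_cong) (simp add: u_def flip_def mem)
    next
      case False
      then have "u y j = x j" for y using pA by (auto simp: u_def flip_def supp_def)
      then show ?thesis by (simp add: degree_at_most_const)
    qed
  qed (auto simp: cube)
  then have deg: "degree_at_most s (deg n f) (\<lambda>y. of_bool (f (u y)))" by simp
  \<comment> \<open>If \<open>f x\<close> holds, the comparison with \<open>f x\<close> is the
    negation, that is 1 minus the value of \<open>f\<close>.\<close>
  have "degree_at_most s (0 + deg n f)
      (\<lambda>y. (if f x then - 1 else 1) * of_bool (f (u y)))"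
    by (rule degree_at_most_mult[OF degree_at_most_const deg])
  then have "degree_at_most s (deg n f)
      (\<lambda>y. (if f x then 1 else 0) + (if f x then - 1 else 1) * of_bool (f (u y)))"
    by (intro degree_at_most_add degree_at_most_const) simp
  then have "degree_at_most s (deg n f) (\<lambda>y. of_bool (f (u y) \<noteq> f x))"
    by (rule degree_at_most_cong) simp
  moreover have "fully_sensitive s (\<lambda>y. f (u y) \<noteq> f x)"
  proof -
    have "u (point s {}) = x" by (simp add: u_def supp_point flip_def)
    moreover have "f (u (point s {i})) \<noteq> f x" if "i < s" for i
      using that pA[OF that] by (simp add: u_def supp_point A_def)
    ultimately show ?thesis unfolding fully_sensitive_def by simp
  qed
  ultimately show ?thesis unfolding s_def[symmetric] deg_le_iff_degree_at_most by blast
qed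

section \<open>The limit over composition powers\<close>

text \<open>The monomial count is at most \<open>(n ^ k + 1) ^ (d ^ k)\<close>, and
  \<open>n ^ k + 1 \<le> (n + 1) ^ k \<le> 2 ^ (n * k)\<close>. This crude bound suffices, as the
  factor besides \<open>d ^ k\<close> is only linear in \<open>k\<close>.\<close>

lemma log2_spar_power_le:
  assumes "deg (n ^ k) h \<le> d ^ k" "fully_sensitive (n ^ k) h" "n > 0" "k > 0"
  shows "log 2 (real (spar (n ^ k) h)) \<le> real d ^ k * (real k * real n)"
proof -
  \<comment> \<open>This fails for \<open>k = 0\<close>, where the two sides are 2 and 1; hence the
    induction starts at 1.\<close>
  have "n ^ k + 1 \<le> (n + 1) ^ k"
    using assms(4)
  proof (induction k rule: nat_induct_non_zero)
    case (Suc k)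
    have "n ^ Suc k + 1 \<le> (n + 1) * (n ^ k + 1)" by simp
    also have "\<dots> \<le> (n + 1) ^ Suc k"
      unfolding power_Suc by (intro mult_le_mono2 Suc.IH)
    finally show ?case .
  qed simp
  also have "\<dots> \<le> (2 ^ n) ^ k" by (intro power_mono) (simp_all add: Suc_leI)
  finally have "(n ^ k + 1) ^ (d ^ k) \<le> ((2 ^ n) ^ k) ^ (d ^ k)" by (intro power_mono) auto
  then have "spar (n ^ k) h \<le> 2 ^ (d ^ k * (k * n))"
    using spar_le_of_deg[OF assms(1)] by (simp add: power_mult[symmetric] mult_ac)
  then have "real (spar (n ^ k) h) \<le> 2 ^ (d ^ k * (k * n))"
    by (metis of_nat_le_iff of_nat_numeral of_nat_power)
  moreover have "spar (n ^ k) h > 0"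
    using fully_sensitive_spar_ge[OF assms(2)] assms(3)
    by (metis less_le_trans zero_less_power)
  ultimately have "log 2 (real (spar (n ^ k) h)) \<le> log 2 (2 ^ (d ^ k * (k * n)))"
    by (intro log_mono) auto
  then show ?thesis by (simp add: log_nat_power)
qed

lemma exponential_not_le_polynomial:
  fixes r :: real
  assumes "r > 1"
  shows "\<not> (\<forall>\<^sub>F k in sequentially. r ^ k \<le> c * real k powr \<alpha>)"
proof
  assume "\<forall>\<^sub>F k in sequentially. r ^ k \<le> c * real k powr \<alpha>"
  moreover have "\<forall>\<^sub>F k in sequentially. c * real k powr \<alpha> < r ^ k"
    using assms by real_asymp
  ultimately have "\<forall>\<^sub>F k in sequentially. False" by eventually_elim simp
  then show False by simp
qed

text \<open>The hypothesis is applied to all composition powers of \<open>f\<close>; as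
  \<open>k\<close> grows, the constant and the polynomial factors disappear. Having
  \<open>n \<ge> 2\<close> makes \<open>n ^ k\<close> unbounded. The sign of \<alpha> is a
  conclusion because the hypothesis does not restrict it.\<close>

lemma fully_sensitive_arity_bound:
  fixes \<alpha> C :: real and K :: nat
  assumes bound: "\<And>n f. spar n f \<ge> K \<Longrightarrow>
      real (mbs n f) \<le> C * log 2 (real (spar n f)) powr \<alpha>"
    and f: "fully_sensitive n f" and n: "n \<ge> 2"
  shows "\<alpha> \<ge> 0 \<and> real n \<le> real (deg n f) powr \<alpha>"
proof -
  define d where "d = deg n f"
  have d: "d > 0" using fully_sensitive_deg_pos[OF f] n by (simp add: d_def)
  \<comment> \<open>\<open>n ^ k \<ge> K\<close> makes the hypothesis applicable, and
    \<open>n ^ k \<ge> 2\<close> makes the logarithm of the sparsity at least 1.\<close>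
  have ev: "\<forall>\<^sub>F k in sequentially. k > 0 \<and> n ^ k \<ge> K \<and> n ^ k \<ge> 2"
  proof (intro eventually_sequentiallyI conjI)
    fix k assume k: "k \<ge> K + 1"
    have "k < n ^ k" using n by (intro less_exp[THEN less_le_trans] power_mono) auto
    then show "n ^ k \<ge> K" "n ^ k \<ge> 2" "k > 0" using k by auto
  qed
  \<comment> \<open>\<open>L\<close> is the logarithm of the sparsity of the \<open>k\<close>-th
    power. Its lower bound serves to exclude negative \<alpha>, its upper bound to handle \<alpha>
    \<ge> 0. Passing to the absolute value of \<open>C\<close> allows estimates of the other
    factor.\<close>
  have step: "\<exists>L\<ge>1. L \<le> real d ^ k * (real k * real n) \<and> real n ^ k \<le> \<bar>C\<bar> * L powr \<alpha>"
    if k: "k > 0" "n ^ k \<ge> K" "n ^ k \<ge> 2" for k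
  proof -
    obtain h where h: "fully_sensitive (n ^ k) h" "deg (n ^ k) h \<le> d ^ k"
      using fully_sensitive_power[OF f, of d k] by (auto simp: d_def)
    let ?L = "log 2 (real (spar (n ^ k) h))"
    have spar: "n ^ k \<le> spar (n ^ k) h" by (rule fully_sensitive_spar_ge[OF h(1)])
    have "?L \<ge> 1" using spar k by (subst le_log_iff) auto
    moreover have "?L \<le> real d ^ k * (real k * real n)"
      using h n k by (intro log2_spar_power_le) auto
    moreover have "real n ^ k \<le> \<bar>C\<bar> * ?L powr \<alpha>"
    proof -
      have "real n ^ k \<le> real (mbs (n ^ k) h)"
        using fully_sensitive_mbs_ge[OF h(1)] by (metis of_nat_le_iff of_nat_power)
      also have "\<dots> \<le> C * ?L powr \<alpha>" using spar k by (intro bound) simp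
      also have "\<dots> \<le> \<bar>C\<bar> * ?L powr \<alpha>" by (intro mult_right_mono) auto
      finally show ?thesis .
    qed
    ultimately show ?thesis by blast
  qed
  have \<alpha>: "\<alpha> \<ge> 0"
  proof (rule ccontr)
    assume neg: "\<not> \<alpha> \<ge> 0"
    \<comment> \<open>For negative \<alpha> the power of \<open>L \<ge> 1\<close> is at most 1, so
      \<open>n ^ k\<close> would stay bounded.\<close>
    have "\<forall>\<^sub>F k in sequentially. real n ^ k \<le> \<bar>C\<bar> * real k powr 0"
      using ev
    proof eventually_elim
      case (elim k)
      then obtain L where L: "L \<ge> 1" "real n ^ k \<le> \<bar>C\<bar> * L powr \<alpha>" using step by blast
      have "L powr \<alpha> \<le> L powr 0" using L neg by (intro powr_mono) auto
      then have "\<bar>C\<bar> * L powr \<alpha> \<le> \<bar>C\<bar> * 1" using L by (intro mult_left_mono) auto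
      then show ?case using L elim by simp
    qed
    moreover have "real n > 1" using n by simp
    ultimately show False using exponential_not_le_polynomial by blast
  qed
  moreover have "real n \<le> real d powr \<alpha>"
  proof (rule ccontr)
    assume "\<not> real n \<le> real d powr \<alpha>"
    \<comment> \<open>Dividing the bound on \<open>n ^ k\<close> by the \<open>k\<close>-th power of
      \<open>real d powr \<alpha>\<close> leaves \<open>r ^ k\<close> below a polynomial in
      \<open>k\<close>, which is impossible for \<open>r > 1\<close>.\<close>
    define r where "r = real n / real d powr \<alpha>"
    have dpos: "real d powr \<alpha> > 0" using d by simp
    have "r > 1" using \<open>\<not> real n \<le> real d powr \<alpha>\<close> dpos by (simp add: r_def)
    have "\<forall>\<^sub>F k in sequentially. r ^ k \<le> (\<bar>C\<bar> * real n powr \<alpha>) * real k powr \<alpha>"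
      using ev
    proof eventually_elim
      case (elim k)
      then obtain L where L: "L \<ge> 1" "L \<le> real d ^ k * (real k * real n)"
        "real n ^ k \<le> \<bar>C\<bar> * L powr \<alpha>" using step by blast
      note L(3)
      also have "\<bar>C\<bar> * L powr \<alpha> \<le> \<bar>C\<bar> * (real d ^ k * (real k * real n)) powr \<alpha>"
        using L \<alpha> by (intro mult_left_mono powr_mono2) auto
      also have "(real d ^ k * (real k * real n)) powr \<alpha>
          = (real d powr \<alpha>) ^ k * (real k powr \<alpha> * real n powr \<alpha>)"
        using d by (simp add: powr_mult powr_powr powr_realpow[symmetric] mult.commute)
      finally show ?case
        using dpos by (simp add: r_def power_divide field_simps)
    qed
    then show False using exponential_not_le_polynomial[OF \<open>r > 1\<close>] by blast
  qed
  ultimately show ?thesis by (simp add: d_def)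
qed

theorem theorem2:
  fixes \<alpha> :: real
  assumes "\<exists>(C::real) (K::nat). \<forall>(n::nat) (f :: (nat \<Rightarrow> bool) \<Rightarrow> bool).
             spar n f \<ge> K \<longrightarrow> real (mbs n f) \<le> C * log 2 (real (spar n f)) powr \<alpha>"
  shows "\<exists>C::real. \<forall>(n::nat) (f :: (nat \<Rightarrow> bool) \<Rightarrow> bool).
           real (sens n f) \<le> C * real (deg n f) powr \<alpha>"
proof -
  obtain C K where bound: "\<And>n f. spar n f \<ge> K \<Longrightarrow>
      real (mbs n f) \<le> C * log 2 (real (spar n f)) powr \<alpha>"
    using assms by blast
  \<comment> \<open>Disjunction of two variables is an instance with at least two variables; it
    serves only to extract \<alpha> \<ge> 0 from the hypothesis.\<close>
  have "fully_sensitive 2 (\<lambda>x. x 0 \<or> x 1)"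
    by (auto simp: fully_sensitive_def point_def less_2_cases_iff)
  then have \<alpha>: "\<alpha> \<ge> 0" using fully_sensitive_arity_bound[OF bound] by blast
  have "real (sens n f) \<le> real (deg n f) powr \<alpha>" for n f
  proof (cases "sens n f = 0")
    case False
    obtain g where g: "fully_sensitive (sens n f) g" "deg (sens n f) g \<le> deg n f"
      using sens_restriction by blast
    have "real (sens n f) \<le> real (deg (sens n f) g) powr \<alpha>"
    \<comment> \<open>The powers of 1 do not grow, so arity 1 is treated directly: the degree is
      positive and \<alpha> \<ge> 0, hence the right side is at least 1.\<close>
    proof (cases "sens n f = 1")
      case True
      then show ?thesis
        using fully_sensitive_deg_pos[OF g(1)] \<alpha> by (simp add: ge_one_powr_ge_zero)
    next
      case neq: False
      then show ?thesis
        using fully_sensitive_arity_bound[OF bound g(1)] False by simp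
    qed
    also have "\<dots> \<le> real (deg n f) powr \<alpha>"
      using g(2) \<alpha> by (intro powr_mono2) auto
    finally show ?thesis .
  qed simp
  \<comment> \<open>The constant 1 works for every \<open>f\<close>, because the limit has absorbed
    both \<open>C\<close> and \<open>K\<close>.\<close>
  then show ?thesis by (intro exI[of _ 1]) simp
qed

end
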